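(* Let $\alpha>0$ be a non-integer real number and $m=\lceil\alpha\rceil$. Let $a\neq 0$ be a real number, $n\in\mathbb{N}$, and $x>a$. Then $${}_aI_x^{\alpha}\,x^n=n!\,(x-a)^{\alpha}\sum_{k=0}^{n}\frac{a^{n-k}(x-a)^k}{(n-k)!\,\Gamma(\alpha+k+1)},$$ $${}_aD_x^{\alpha}\,x^n=n!\,(x-a)^{-\alpha}\sum_{k=0}^{n}\frac{a^{n-k}(x-a)^k}{(n-k)!\,\Gamma(k-\alpha+1)},$$ $${}_a^{C}D_x^{\alpha}\,x^n=n!\,a^{-m}(x-a)^{m-\alpha}\sum_{k=0}^{n-m}\frac{a^{n-k}(x-a)^k}{(n-m-k)!\,\Gamma(m-\alpha+k+1)}.$$
   Context: Throughout, $\alpha>0$ is a non-integer real number and $m=\lceil\alpha\rceil$. For a function $f$ and $x>a$: the left-sided Riemann-Liouville fractional integral of order $\alpha$ is ${}_aI_x^{\alpha}f(x)=\frac{1}{\Gamma(\alpha)}\int_a^x(x-\tau)^{\alpha-1}f(\tau)\,d\tau$; the left-sided Riemann-Liouville fractional derivative of order $\alpha$ is ${}_aD_x^{\alpha}f(x)=\frac{1}{\Gamma(m-\alpha)}\frac{d^m}{dx^m}\int_a^x(x-\tau)^{m-\alpha-1}f(\tau)\,d\tau$; the left-sided Caputo fractional derivative of order $\alpha$ is ${}_a^{C}D_x^{\alpha}f(x)=\frac{1}{\Gamma(m-\alpha)}\int_a^x(x-\tau)^{m-\alpha-1}f^{(m)}(\tau)\,d\tau$. Notation such as ${}_aI_x^{\alpha}\,x^n$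 means the operator applied to the function $\tau\mapsto\tau^n$, evaluated at $x$. $\Gamma$ is the Gamma function. A sum whose upper limit is smaller than its lower limit is empty, i.e. equal to $0$. *)

theory Defs
  imports "HOL-Analysis.Analysis"
begin

(* All operators are total functions of x and are meaningful for a < x.  At the endpoint \<tau> = x the
   kernel takes the value 0 (as 0 powr b = 0), which does not affect the integral. *)

definition RL_integral :: "real \<Rightarrow> real \<Rightarrow> (real \<Rightarrow> real) \<Rightarrow> real \<Rightarrow> real" where
  "RL_integral a \<alpha> f x =
     1 / Gamma \<alpha> * integral {a..x} (\<lambda>\<tau>. (x - \<tau>) powr (\<alpha> - 1) * f \<tau>)"

definition RL_deriv :: "real \<Rightarrow> real \<Rightarrow> (real \<Rightarrow> real) \<Rightarrow> real \<Rightarrow> real" where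
  "RL_deriv a \<alpha> f x =
     (let m = nat \<lceil>\<alpha>\<rceil> in
       1 / Gamma (real m - \<alpha>) *
       (deriv ^^ m) (\<lambda>y. integral {a..y} (\<lambda>\<tau>. (y - \<tau>) powr (real m - \<alpha> - 1) * f \<tau>)) x)"

definition Caputo_deriv :: "real \<Rightarrow> real \<Rightarrow> (real \<Rightarrow> real) \<Rightarrow> real \<Rightarrow> real" where
  "Caputo_deriv a \<alpha> f x =
     (let m = nat \<lceil>\<alpha>\<rceil> in
       1 / Gamma (real m - \<alpha>) *
       integral {a..x} (\<lambda>\<tau>. (x - \<tau>) powr (real m - \<alpha> - 1) * (deriv ^^ m) f \<tau>))"

end

theory Submission
  imports Defs
begin

text \<open>
  All three identities concern one family of functions, \<open>frac_power a n c\<close> with a real parameter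
  \<open>c\<close>: the image of \<open>\<tau>\<^sup>n\<close> under fractional integration of order \<open>c\<close> when \<open>c > 0\<close>, and its
  continuation in \<open>c\<close> otherwise.

  Expand \<open>\<tau>\<^sup>n = (a + (\<tau> - a))\<^sup>n\<close> by the binomial theorem. Each power \<open>(\<tau> - a)\<^sup>k\<close> is integrated
  against the kernel \<open>(x - \<tau>)\<^sup>b\<^sup>-\<^sup>1\<close> by Euler's Beta integral, which gives
  \<open>\<Gamma>(b) k! (x - a)\<^sup>b\<^sup>+\<^sup>k / \<Gamma>(b + k + 1)\<close>. Summing, the fractional integral of order \<open>b > 0\<close> of
  \<open>\<tau>\<^sup>n\<close> is \<open>frac_power a n b\<close> (lemma \<open>RL_integral_power\<close>); this is the first identity.

  Since \<open>z / \<Gamma>(z + 1) = 1 / \<Gamma>(z)\<close>, differentiation lowers the parameter \<open>c\<close> by one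
  (\<open>has_real_derivative_frac_power\<close>). The Riemann-Liouville derivative is the \<open>m\<close>-th derivative of
  the integral of order \<open>m - \<alpha>\<close>, so it is \<open>frac_power a n (- \<alpha>)\<close>. For the Caputo derivative one
  differentiates first: the \<open>m\<close>-th derivative of \<open>\<tau>\<^sup>n\<close> is \<open>n! / (n - m)! \<tau>\<^sup>n\<^sup>-\<^sup>m\<close>, or zero if
  \<open>m > n\<close>, and the fractional integral of order \<open>m - \<alpha> > 0\<close> of this is again covered by
  \<open>RL_integral_power\<close>. That \<open>m - \<alpha>\<close> is positive uses that \<open>\<alpha>\<close> is not an integer.
\<close>

text \<open>
  The entire function \<open>1 / \<Gamma>\<close> appears in place of division by \<open>\<Gamma>\<close>, so that the recurrence
  of \<open>\<Gamma>\<close> can be used for every real \<open>c\<close> without excluding poles.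
\<close>

definition frac_power :: "real \<Rightarrow> nat \<Rightarrow> real \<Rightarrow> real \<Rightarrow> real" where
  "frac_power a n c y =
     (\<Sum>k\<le>n. fact n / fact (n - k) * a ^ (n - k) * (rGamma (c + real k + 1) * (y - a) powr (c + real k)))"

lemma has_integral_Beta_power:
  fixes b :: real
  assumes "b > 0"
  shows "((\<lambda>t. (1 - t) powr (b - 1) * t ^ k) has_integral Gamma b * fact k * rGamma (b + real k + 1)) {0..1}"
proof -
  have "((\<lambda>t. t powr (real k + 1 - 1) * (1 - t) powr (b - 1)) has_integral Beta (real k + 1) b) {0..1}"
    by (rule has_integral_Beta_real) (use assms in auto)
  moreover have "Beta (real k + 1) b = Gamma b * fact k * rGamma (b + real k + 1)"
    using Gamma_fact[of k, where ?'a = real]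
    by (simp add: Beta_def rGamma_inverse_Gamma field_simps)
  ultimately have beta: "((\<lambda>t. t powr real k * (1 - t) powr (b - 1)) has_integral
      Gamma b * fact k * rGamma (b + real k + 1)) {0..1}"
    by simp
  \<comment> \<open>At \<open>t = 0\<close> and \<open>k = 0\<close> the two integrands differ, as \<open>0 powr 0 = 0\<close> but \<open>0 ^ 0 = 1\<close>.\<close>
  show ?thesis
    by (rule has_integral_spike_finite[OF _ _ beta, of "{0}"]) (auto simp: powr_realpow)
qed

lemma has_integral_Beta_power_interval:
  fixes a b x :: real
  assumes "b > 0" "x > a"
  shows "((\<lambda>\<tau>. (x - \<tau>) powr (b - 1) * (\<tau> - a) ^ k) has_integral
            Gamma b * fact k * (rGamma (b + real k + 1) * (x - a) powr (b + real k))) {a..x}"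
proof -
  define d where "d = x - a"
  have d: "d > 0" using assms by (simp add: d_def)
  define I where "I = Gamma b * fact k * rGamma (b + real k + 1)"
  \<comment> \<open>The substitution \<open>t = (\<tau> - a) / d\<close> maps \<open>{a..x}\<close> onto \<open>{0..1}\<close>.\<close>
  have "((\<lambda>\<tau>. (1 - (inverse d *\<^sub>R \<tau> + - (a / d))) powr (b - 1) * (inverse d *\<^sub>R \<tau> + - (a / d)) ^ k)
          has_integral I /\<^sub>R inverse d ^ DIM(real)) (cbox ((0 - - (a / d)) /\<^sub>R inverse d) ((1 - - (a / d)) /\<^sub>R inverse d))"
    by (rule has_integral_affinity')
      (use has_integral_Beta_power[OF assms(1), of k] d in \<open>simp_all add: I_def\<close>)
  moreover have "(0 - - (a / d)) /\<^sub>R inverse d = a" "(1 - - (a / d)) /\<^sub>R inverse d = x"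
    using d by (auto simp: d_def field_simps)
  moreover have "inverse d *\<^sub>R \<tau> + - (a / d) = (\<tau> - a) / d" for \<tau>
    by (simp add: divide_inverse algebra_simps)
  ultimately have "((\<lambda>\<tau>. (1 - (\<tau> - a) / d) powr (b - 1) * ((\<tau> - a) / d) ^ k) has_integral d * I) {a..x}"
    by simp
  then have "((\<lambda>\<tau>. d powr (b + real k - 1) * ((1 - (\<tau> - a) / d) powr (b - 1) * ((\<tau> - a) / d) ^ k))
       has_integral d powr (b + real k - 1) * (d * I)) {a..x}"
    by (rule has_integral_mult_right)
  moreover have "d powr (b + real k - 1) * (d * I) = I * d powr (b + real k)"
    using d by (simp add: powr_diff)
  moreover have "d powr (b + real k - 1) * ((1 - (\<tau> - a) / d) powr (b - 1) * ((\<tau> - a) / d) ^ k)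
      = (x - \<tau>) powr (b - 1) * (\<tau> - a) ^ k" if "\<tau> \<in> {a..x}" for \<tau>
  proof -
    have "1 - (\<tau> - a) / d = (x - \<tau>) / d" using d by (simp add: d_def field_simps)
    moreover have "d powr (b + real k - 1) = d powr (b - 1) * d ^ k"
      using d by (simp add: powr_add powr_diff powr_realpow)
    ultimately show ?thesis using d that by (simp add: powr_divide power_divide)
  qed
  ultimately have "((\<lambda>\<tau>. (x - \<tau>) powr (b - 1) * (\<tau> - a) ^ k) has_integral I * d powr (b + real k)) {a..x}"
    by (metis (mono_tags, lifting) has_integral_eq)
  then show ?thesis by (simp add: I_def d_def mult.assoc)
qed

lemma has_integral_kernel_power:
  fixes a b x :: real
  assumes "b > 0" "x > a"
  shows "((\<lambda>\<tau>. (x - \<tau>) powr (b - 1) * \<tau> ^ n) has_integral Gamma b * frac_power a n b x) {a..x}"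
proof -
  have "((\<lambda>\<tau>. \<Sum>k\<le>n. (real (n choose k) * a ^ (n - k)) * ((x - \<tau>) powr (b - 1) * (\<tau> - a) ^ k)) has_integral
     (\<Sum>k\<le>n. (real (n choose k) * a ^ (n - k)) *
        (Gamma b * fact k * (rGamma (b + real k + 1) * (x - a) powr (b + real k))))) {a..x}"
    by (intro has_integral_sum has_integral_mult_right has_integral_Beta_power_interval assms) auto
  moreover have "(\<Sum>k\<le>n. (real (n choose k) * a ^ (n - k)) * ((x - \<tau>) powr (b - 1) * (\<tau> - a) ^ k))
      = (x - \<tau>) powr (b - 1) * \<tau> ^ n" for \<tau>
    using binomial_ring[of "\<tau> - a" a n] by (simp add: sum_distrib_left mult_ac)
  moreover have "(\<Sum>k\<le>n. (real (n choose k) * a ^ (n - k)) *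
        (Gamma b * fact k * (rGamma (b + real k + 1) * (x - a) powr (b + real k))))
      = Gamma b * frac_power a n b x"
    unfolding frac_power_def sum_distrib_left
    by (intro sum.cong refl) (simp add: binomial_fact field_simps)
  ultimately show ?thesis by simp
qed

lemma RL_integral_power:
  assumes "b > 0" "x > a"
  shows "RL_integral a b (\<lambda>\<tau>. \<tau> ^ n) x = frac_power a n b x"
  using integral_unique[OF has_integral_kernel_power[OF assms]] Gamma_real_pos[OF assms(1)]
  by (simp add: RL_integral_def)

text \<open>
  Differentiating a summand produces the factor \<open>c + 1 + k\<close>, which turns \<open>1 / \<Gamma>(c + k + 2)\<close>
  into \<open>1 / \<Gamma>(c + k + 1)\<close>.
\<close>

lemma has_real_derivative_frac_power:
  assumes "y > a"
  shows "(frac_power a n (c + 1) has_real_derivative frac_power a n c y) (at y)"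
proof -
  have "((\<lambda>y. rGamma (c + 1 + real k + 1) * (y - a) powr (c + 1 + real k)) has_real_derivative
          rGamma (c + real k + 1) * (y - a) powr (c + real k)) (at y)" for k
  proof -
    have "((\<lambda>y. (y - a) powr (c + 1 + real k)) has_real_derivative
            (c + 1 + real k) * (y - a) powr (c + real k)) (at y)"
      using assms by (auto intro!: derivative_eq_intros simp: algebra_simps)
    from DERIV_cmult[OF this, of "rGamma (c + 1 + real k + 1)"]
    have "((\<lambda>y. rGamma (c + 1 + real k + 1) * (y - a) powr (c + 1 + real k)) has_real_derivative
            (rGamma (c + 1 + real k + 1) * (c + 1 + real k)) * (y - a) powr (c + real k)) (at y)"
      by (simp only: mult.assoc)
    moreover have "rGamma (c + 1 + real k + 1) * (c + 1 + real k) = rGamma (c + real k + 1)"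
      using rGamma_plus1[of "c + 1 + real k"] by (simp add: algebra_simps)
    ultimately show ?thesis
      by (simp only:)
  qed
  then show ?thesis
    unfolding frac_power_def[abs_def]
    by (intro DERIV_sum DERIV_cmult)
qed

text \<open>
  The identification of \<open>g\<close> is available only to the right of \<open>a\<close>. That half-line is open, so it
  carries over to derivatives; the conclusion for all its points feeds the induction, which peels
  off the outermost derivative while the parameter \<open>c\<close> varies.
\<close>

lemma higher_deriv_frac_power:
  assumes "\<And>y. y > a \<Longrightarrow> g y = K * frac_power a n (c + real m) y" "x > a"
  shows "(deriv ^^ m) g x = K * frac_power a n c x"
  using assms
proof (induction m arbitrary: c x)
  case (Suc m)
  have "(deriv ^^ m) g y = K * frac_power a n (c + 1) y" if "y > a" for y
    by (rule Suc.IH) (use Suc.prems that in \<open>auto simp: add_ac\<close>)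
  then have "\<forall>\<^sub>F y in nhds x. (deriv ^^ m) g y = K * frac_power a n (c + 1) y"
    using Suc.prems by (auto intro: eventually_mono[OF eventually_nhds_in_open[of "{a<..}" x]])
  then have "(deriv ^^ Suc m) g x = deriv (\<lambda>y. K * frac_power a n (c + 1) y) x"
    by (simp add: deriv_cong_ev)
  also have "\<dots> = K * frac_power a n c x"
    by (intro DERIV_imp_deriv DERIV_cmult has_real_derivative_frac_power Suc.prems)
  finally show ?case .
qed auto

lemma higher_deriv_power_real:
  "(deriv ^^ m) (\<lambda>\<tau>::real. \<tau> ^ n) =
     (\<lambda>\<tau>. if m \<le> n then fact n / fact (n - m) * \<tau> ^ (n - m) else 0)"
proof (induction m)
  case (Suc m)
  show ?case
  proof
    fix \<tau> :: real
    have "((\<lambda>\<tau>. if m \<le> n then fact n / fact (n - m) * \<tau> ^ (n - m) else 0) has_real_derivative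
        (if Suc m \<le> n then fact n / fact (n - Suc m) * \<tau> ^ (n - Suc m) else 0)) (at \<tau>)"
    proof (cases "Suc m \<le> n")
      case True
      then have eq: "n - m = Suc (n - Suc m)" by simp
      have "((\<lambda>\<tau>. fact n / fact (n - m) * \<tau> ^ (n - m)) has_real_derivative
          fact n / fact (n - m) * (real (n - m) * \<tau> ^ (n - m - Suc 0))) (at \<tau>)"
        by (intro DERIV_cmult DERIV_pow)
      then show ?thesis using True by (simp add: eq field_simps del: of_nat_Suc)
    next
      case False
      then have "(\<lambda>\<tau>::real. if m \<le> n then fact n / fact (n - m) * \<tau> ^ (n - m) else 0)
          = (\<lambda>\<tau>. if m \<le> n then fact n else 0)"
        by auto
      then show ?thesis using False by simp
    qed
    then show "(deriv ^^ Suc m) (\<lambda>\<tau>::real. \<tau> ^ n) \<tau> =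
        (if Suc m \<le> n then fact n / fact (n - Suc m) * \<tau> ^ (n - Suc m) else 0)"
      using Suc by (simp add: DERIV_imp_deriv)
  qed
qed auto

lemma frac_power_factored:
  assumes "y > a"
  shows "frac_power a n c y =
    fact n * (y - a) powr c * (\<Sum>k=0..n. a ^ (n - k) * (y - a) ^ k / (fact (n - k) * Gamma (c + real k + 1)))"
  unfolding frac_power_def sum_distrib_left using assms
  by (intro sum.cong) (auto simp: powr_add powr_realpow rGamma_inverse_Gamma field_simps)

theorem theorem9:
  fixes \<alpha> a x :: real and m n :: nat
  assumes "\<alpha> > 0" and "\<alpha> \<notin> \<int>" and "m = nat \<lceil>\<alpha>\<rceil>"
    and "a \<noteq> 0" and "x > a"
  shows "RL_integral a \<alpha> (\<lambda>\<tau>. \<tau> ^ n) x =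
           fact n * (x - a) powr \<alpha> *
           (\<Sum>k=0..n. a ^ (n - k) * (x - a) ^ k / (fact (n - k) * Gamma (\<alpha> + real k + 1))) \<and>
         RL_deriv a \<alpha> (\<lambda>\<tau>. \<tau> ^ n) x =
           fact n * (x - a) powr (- \<alpha>) *
           (\<Sum>k=0..n. a ^ (n - k) * (x - a) ^ k / (fact (n - k) * Gamma (real k - \<alpha> + 1))) \<and>
         Caputo_deriv a \<alpha> (\<lambda>\<tau>. \<tau> ^ n) x =
           fact n * a powi (- int m) * (x - a) powr (real m - \<alpha>) *
           (\<Sum>k | k + m \<le> n. a ^ (n - k) * (x - a) ^ k /
              (fact (n - m - k) * Gamma (real m - \<alpha> + real k + 1)))"
proof (intro conjI)
  have "\<alpha> \<le> real m"
    using assms(1,3) by linarith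
  moreover have "\<alpha> \<noteq> real m"
    using assms(2) by auto
  ultimately have pos: "real m - \<alpha> > 0"
    by simp
  show "RL_integral a \<alpha> (\<lambda>\<tau>. \<tau> ^ n) x =
           fact n * (x - a) powr \<alpha> *
           (\<Sum>k=0..n. a ^ (n - k) * (x - a) ^ k / (fact (n - k) * Gamma (\<alpha> + real k + 1)))"
    using assms by (simp add: RL_integral_power frac_power_factored)
  have "(deriv ^^ m) (\<lambda>y. integral {a..y} (\<lambda>\<tau>. (y - \<tau>) powr (real m - \<alpha> - 1) * \<tau> ^ n)) x
      = Gamma (real m - \<alpha>) * frac_power a n (- \<alpha>) x"
    using integral_unique[OF has_integral_kernel_power[OF pos]] assms(5)
    by (intro higher_deriv_frac_power) (auto simp: add_ac)
  then have "RL_deriv a \<alpha> (\<lambda>\<tau>. \<tau> ^ n) x = frac_power a n (- \<alpha>) x"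
    using Gamma_real_pos[OF pos] by (simp add: RL_deriv_def Let_def flip: assms(3))
  then show "RL_deriv a \<alpha> (\<lambda>\<tau>. \<tau> ^ n) x =
           fact n * (x - a) powr (- \<alpha>) *
           (\<Sum>k=0..n. a ^ (n - k) * (x - a) ^ k / (fact (n - k) * Gamma (real k - \<alpha> + 1)))"
    using assms(5) by (simp add: frac_power_factored add_ac)
  have caputo: "Caputo_deriv a \<alpha> f x = RL_integral a (real m - \<alpha>) ((deriv ^^ m) f) x" for f
    by (simp add: Caputo_deriv_def RL_integral_def Let_def flip: assms(3))
  show "Caputo_deriv a \<alpha> (\<lambda>\<tau>. \<tau> ^ n) x =
           fact n * a powi (- int m) * (x - a) powr (real m - \<alpha>) *
           (\<Sum>k | k + m \<le> n. a ^ (n - k) * (x - a) ^ k /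
              (fact (n - m - k) * Gamma (real m - \<alpha> + real k + 1)))"
  proof (cases "m \<le> n")
    case True
    have "Caputo_deriv a \<alpha> (\<lambda>\<tau>. \<tau> ^ n) x
        = fact n / fact (n - m) * RL_integral a (real m - \<alpha>) (\<lambda>\<tau>. \<tau> ^ (n - m)) x"
      using True by (simp add: caputo higher_deriv_power_real RL_integral_def mult.left_commute)
    also have "\<dots> = fact n * (x - a) powr (real m - \<alpha>) *
        (\<Sum>k=0..n - m. a ^ (n - m - k) * (x - a) ^ k /
              (fact (n - m - k) * Gamma (real m - \<alpha> + real k + 1)))"
      using pos assms(5) by (simp add: RL_integral_power frac_power_factored)
    also have "(\<Sum>k=0..n - m. a ^ (n - m - k) * (x - a) ^ k /
              (fact (n - m - k) * Gamma (real m - \<alpha> + real k + 1)))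
        = (\<Sum>k | k + m \<le> n. a powi (- int m) * (a ^ (n - k) * (x - a) ^ k /
              (fact (n - m - k) * Gamma (real m - \<alpha> + real k + 1))))"
    proof (rule sum.cong)
      show "{0..n - m} = {k. k + m \<le> n}" using True by auto
    next
      fix k assume "k \<in> {k. k + m \<le> n}"
      then have "n - k = m + (n - m - k)" by simp
      then have "a powi (- int m) * a ^ (n - k) = a ^ (n - m - k)"
        using assms(4) by (simp add: power_int_minus power_add)
      then show "a ^ (n - m - k) * (x - a) ^ k / (fact (n - m - k) * Gamma (real m - \<alpha> + real k + 1))
          = a powi (- int m) * (a ^ (n - k) * (x - a) ^ k /
              (fact (n - m - k) * Gamma (real m - \<alpha> + real k + 1)))"
        by (metis mult.assoc times_divide_eq_right)
    qed
    finally show ?thesis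
      by (simp only: sum_distrib_left[symmetric] mult_ac)
  next
    case False
    then have "{k. k + m \<le> n} = {}" by auto
    with False show ?thesis
      by (simp add: caputo higher_deriv_power_real RL_integral_def)
  qed
qed

end
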